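(* Let $\hat\beta$ be the Lasso estimator with tuning parameter $\lambda>0$, i.e. a minimizer over $\beta\in\mathbb{R}^p$ of $\|Y-X\beta\|_n^2+2\lambda\|\beta\|_1$, where $Y=X\beta^0+\epsilon$. Let $\lambda_\epsilon\ge\|\epsilon^TX\|_\infty/n$. Let $0\le\delta<1$ be arbitrary and, for $\lambda>\lambda_\epsilon$, define $$L:=\frac{\lambda+\lambda_\epsilon+\delta(\lambda-\lambda_\epsilon)}{(1-\delta)(\lambda-\lambda_\epsilon)},\qquad \lambda_*:=\lambda+\lambda_\epsilon+\delta(\lambda-\lambda_\epsilon).$$ Let $$\beta^*:=\arg\min\Big\{\|X(\beta-\beta^0)\|_n^2+\lambda_*^2|S_\beta|/\hat\phi^2(L,S_\beta):\ \|\beta\|_1\ge\|\beta^0\|_1\Big\}$$ and let $S_*$ be the active set of $\beta^*$. Then $$2\delta(\lambda-\lambda_\epsilon)\|\hat\beta-\beta^0\|_1+\|X(\hat\beta-\beta^0)\|_n^2\le\frac{\lambda+\lambda_\epsilon+3\delta(\lambda-\lambda_\epsilon)}{\lambda+\lambda_\epsilon+\delta(\lambda-\lambda_\epsilon)}\|X(\beta^*-\beta^0)\|_n^2$$ $$+\big(\lambda+\lambda_\epsilon+3\delta(\lambda-\lambda_\epsilon)\big)\big(\lambda+\lambda_\epsilon+\delta(\lambda-\lambda_\epsilon)\big)\frac{|S_*|}{\hat\phi^2(L,S_* )}.$$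
   Context: $X$ is a fixed $n\times p$ real matrix of rank $n$, $Y\in\mathbb{R}^n$, $f^0=\mathbb{E}Y$, $\beta^0\in\mathbb{R}^p$ is a solution of $X\beta^0=f^0$, and $\epsilon:=Y-f^0$, so $Y=X\beta^0+\epsilon$ (the result is deterministic: it holds for any realization of $\epsilon$). For $v\in\mathbb{R}^n$, $\|v\|_n:=\sqrt{v^Tv/n}$. For $\beta\in\mathbb{R}^p$, $S_\beta:=\{j:\beta_j\ne0\}$ is its active set. For $S\subset\{1,\dots,p\}$, $\beta_S\in\mathbb{R}^p$ has entries $\beta_j$ for $j\in S$ and $0$ otherwise. The compatibility constant, for $L>0$, is $$\hat\phi^2(L,S):=\min\{|S|\,\|X\beta_S-X\beta_{S^c}\|_n^2:\ \|\beta_S\|_1=1,\ \|\beta_{S^c}\|_1\le L\}.$$ Conventions: $|S|/\hat\phi^2(L,S)$ is $0$ if $S=\emptyset$ and $+\infty$ if $S\ne\emptyset$ and $\hat\phi(L,S)=0$. $\beta^*$ is any minimizer (assumed to exist). *)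

theory Defs
  imports "HOL-Analysis.Analysis"
begin

definition nnorm :: "real ^ 'n \<Rightarrow> real" where
  "nnorm v = sqrt ((v \<bullet> v) / real CARD('n))"

definition l1norm :: "real ^ 'p \<Rightarrow> real" where
  "l1norm \<beta> = (\<Sum>j\<in>UNIV. \<bar>\<beta> $ j\<bar>)"

definition active_set :: "real ^ 'p \<Rightarrow> 'p set" where
  "active_set \<beta> = {j. \<beta> $ j \<noteq> 0}"

definition vrestrict :: "'p set \<Rightarrow> real ^ 'p \<Rightarrow> real ^ 'p" where
  "vrestrict S \<beta> = (\<chi> j. if j \<in> S then \<beta> $ j else 0)"

definition compat_feasible :: "real \<Rightarrow> 'p set \<Rightarrow> (real ^ 'p) set" where
  "compat_feasible L S =
     {\<beta>. l1norm (vrestrict S \<beta>) = 1 \<and> l1norm (vrestrict (- S) \<beta>) \<le> L}"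

text \<open>
  The squared compatibility constant. For nonempty \<open>S\<close> and \<open>L > 0\<close> the infimum is a minimum,
  see \<open>compat_sq_attained\<close> below; for empty \<open>S\<close> the feasible set is empty and the value is
  irrelevant.
\<close>
definition compat_sq :: "real ^ 'p ^ 'n \<Rightarrow> real \<Rightarrow> 'p set \<Rightarrow> real" where
  "compat_sq X L S =
     (INF \<beta> \<in> compat_feasible L S.
        real (card S) * (nnorm (X *v vrestrict S \<beta> - X *v vrestrict (- S) \<beta>))\<^sup>2)"

definition compat_ratio :: "real ^ 'p ^ 'n \<Rightarrow> real \<Rightarrow> 'p set \<Rightarrow> ereal" where
  "compat_ratio X L S =
     (if S = {} then 0
      else if compat_sq X L S = 0 then \<infinity>
      else ereal (real (card S) / compat_sq X L S))"

definition is_lasso ::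
  "real ^ 'p ^ 'n \<Rightarrow> real ^ 'n \<Rightarrow> real \<Rightarrow> real ^ 'p \<Rightarrow> bool" where
  "is_lasso X Y lam =
     is_arg_min (\<lambda>\<beta>. (nnorm (Y - X *v \<beta>))\<^sup>2 + 2 * lam * l1norm \<beta>) (\<lambda>_. True)"

lemma compact_compat_feasible: "compact (compat_feasible L (S :: 'p::finite set))"
proof -
  have sum_eq: "l1norm (vrestrict S b) + l1norm (vrestrict (- S) b) = l1norm b" for b :: "real ^ 'p"
    unfolding l1norm_def vrestrict_def sum.distrib[symmetric] by (rule sum.cong) auto
  have "norm b \<le> 1 + L" if "b \<in> compat_feasible L S" for b :: "real ^ 'p"
    using that sum_eq[of b] norm_le_l1_cart[of b]
    unfolding compat_feasible_def l1norm_def by simp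
  then have "bounded (compat_feasible L S)"
    unfolding bounded_iff by blast
  moreover have cont: "continuous_on UNIV (\<lambda>b :: real ^ 'p. l1norm (vrestrict T b))" for T
  proof -
    have "(\<lambda>b :: real ^ 'p. l1norm (vrestrict T b)) =
          (\<lambda>b. \<Sum>j\<in>UNIV. \<bar>if j \<in> T then b $ j else 0\<bar>)"
      by (simp add: l1norm_def vrestrict_def)
    moreover have "continuous_on UNIV (\<lambda>b :: real ^ 'p. \<bar>if j \<in> T then b $ j else 0\<bar>)" for j
      by (cases "j \<in> T") (auto intro!: continuous_intros)
    ultimately show ?thesis
      by (simp only:) (intro continuous_on_sum)
  qed
  have "closed (compat_feasible L S)"
    unfolding compat_feasible_def
    by (intro closed_Collect_conj closed_Collect_eq closed_Collect_le cont continuous_on_const)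
  ultimately show ?thesis
    by (simp add: compact_eq_bounded_closed)
qed

lemma compat_feasible_nonempty:
  assumes "S \<noteq> {}" "L > 0"
  shows "compat_feasible L (S :: 'p::finite set) \<noteq> {}"
proof -
  from assms obtain k where k: "k \<in> S" by auto
  have "vrestrict S (axis k 1) = (axis k 1 :: real ^ 'p)"
    and "vrestrict (- S) (axis k 1) = (0 :: real ^ 'p)"
    using k by (auto simp: vrestrict_def axis_def vec_eq_iff)
  moreover have "l1norm (axis k 1 :: real ^ 'p) = 1"
    by (simp add: l1norm_def axis_def if_distrib cong: if_cong)
  ultimately have "axis k 1 \<in> compat_feasible L S"
    using assms by (simp add: compat_feasible_def l1norm_def)
  then show ?thesis by blast
qed

lemma compat_sq_attained:
  fixes X :: "real ^ 'p::finite ^ 'n::finite"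
  assumes "S \<noteq> {}" "L > 0"
  obtains b where "b \<in> compat_feasible L S"
    and "compat_sq X L S = real (card S) * (nnorm (X *v vrestrict S b - X *v vrestrict (- S) b))\<^sup>2"
    and "\<And>b'. b' \<in> compat_feasible L S \<Longrightarrow>
      compat_sq X L S \<le> real (card S) * (nnorm (X *v vrestrict S b' - X *v vrestrict (- S) b'))\<^sup>2"
proof -
  define f where "f b = real (card S) * (nnorm (X *v vrestrict S b - X *v vrestrict (- S) b))\<^sup>2" for b
  have lin: "linear (vrestrict T :: real ^ 'p \<Rightarrow> real ^ 'p)" for T
    by (rule linearI) (auto simp: vrestrict_def vec_eq_iff)
  have "continuous_on A (\<lambda>b. X *v vrestrict T b)" for A T
    using linear_continuous_on[OF linear_conv_bounded_linear[THEN iffD1,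
        OF linear_compose[OF lin matrix_vector_mul_linear[of X]]]]
    by (simp add: o_def)
  then have "continuous_on (compat_feasible L S) f"
    unfolding f_def nnorm_def by (intro continuous_intros) auto
  then obtain b where b: "b \<in> compat_feasible L S" "\<And>b'. b' \<in> compat_feasible L S \<Longrightarrow> f b \<le> f b'"
    using continuous_attains_inf[OF compact_compat_feasible compat_feasible_nonempty[OF assms]]
    by blast
  then have "compat_sq X L S = f b"
    unfolding compat_sq_def f_def[symmetric] by (intro cInf_eq_minimum) auto
  with b show thesis
    by (intro that[of b]) (auto simp: f_def)
qed

end

theory Submission
  imports Defs
begin

text \<open>
  First-order optimality of the Lasso gives, for every \<open>\<beta>\<close> with active set \<open>S\<close> and \<open>u = \<beta>hat - \<beta>\<close>,
  a bound on the inner product of \<open>X u\<close> and \<open>X (\<beta>hat - \<beta>0)\<close> by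
  \<open>(lam + lam_eps) * |u_S|_1 - (lam - lam_eps) * |u_{-S}|_1\<close>. Either this inner product is so negative
  that the claim is immediate, or \<open>u\<close> lies in the cone \<open>|u_{-S}|_1 \<le> L * |u_S|_1\<close>, where compatibility
  applies. This bounds the \<open>l1\<close> distance from \<open>\<beta>hat\<close> to \<open>\<beta>star\<close>. The constraint
  \<open>|\<beta>star|_1 \<ge> |\<beta>0|_1\<close> puts \<open>\<beta>star - \<beta>0\<close> in the cone with constant \<open>1 \<le> L\<close>, so compatibility also
  bounds the remaining distance from \<open>\<beta>star\<close> to \<open>\<beta>0\<close>.
\<close>

section \<open>Norms, restriction to coordinate sets, and duality\<close>

lemma l1norm_nonneg: "0 \<le> l1norm v"
  unfolding l1norm_def by (intro sum_nonneg) auto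

lemma l1norm_triangle: "l1norm (v + w) \<le> l1norm v + l1norm w"
  unfolding l1norm_def sum.distrib[symmetric] by (intro sum_mono) auto

lemma l1norm_scaleR: "l1norm (c *\<^sub>R v) = \<bar>c\<bar> * l1norm v"
  unfolding l1norm_def by (simp add: sum_distrib_left abs_mult)

lemma l1norm_uminus: "l1norm (- v) = l1norm v"
  unfolding l1norm_def by simp

lemma l1norm_split: "l1norm v = l1norm (vrestrict S v) + l1norm (vrestrict (- S) v)"
  unfolding l1norm_def vrestrict_def sum.distrib[symmetric] by (rule sum.cong) auto

lemma vrestrict_diff: "vrestrict S (v - w) = vrestrict S v - vrestrict S w"
  by (simp add: vrestrict_def vec_eq_iff)

lemma vrestrict_scaleR: "vrestrict S (c *\<^sub>R v) = c *\<^sub>R vrestrict S v"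
  by (simp add: vrestrict_def vec_eq_iff)

lemma vrestrict_vrestrict: "vrestrict S (vrestrict T v) = vrestrict (S \<inter> T) v"
  by (auto simp: vrestrict_def vec_eq_iff)

lemma vrestrict_empty: "vrestrict {} v = 0"
  by (simp add: vrestrict_def vec_eq_iff)

lemma vrestrict_plus_compl: "vrestrict S v + vrestrict (- S) v = v"
  by (simp add: vrestrict_def vec_eq_iff)

lemma vrestrict_compl_active_set: "vrestrict (- active_set v) v = 0"
  by (simp add: vrestrict_def active_set_def vec_eq_iff)

lemma nnorm_sq: "(nnorm (v :: real ^ 'n))\<^sup>2 = (v \<bullet> v) / real CARD('n)"
  unfolding nnorm_def by (simp add: inner_ge_zero)

lemma nnorm_scaleR_sq: "(nnorm (c *\<^sub>R v))\<^sup>2 = c\<^sup>2 * (nnorm v)\<^sup>2"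
  by (simp add: nnorm_sq) (simp add: power2_eq_square)

text \<open>Hoelder's inequality for the dual pair of sup norm and \<open>l1norm\<close>; it
  controls the noise term.\<close>

lemma inner_le_infnorm_l1norm: "w \<bullet> u \<le> infnorm w * l1norm u"
proof -
  have "w \<bullet> u = (\<Sum>j\<in>UNIV. w $ j * u $ j)"
    by (simp add: inner_vec_def)
  also have "\<dots> \<le> (\<Sum>j\<in>UNIV. infnorm w * \<bar>u $ j\<bar>)"
  proof (intro sum_mono)
    fix j
    have "w $ j * u $ j \<le> \<bar>w $ j\<bar> * \<bar>u $ j\<bar>"
      by (metis abs_ge_self abs_mult)
    also have "\<dots> \<le> infnorm w * \<bar>u $ j\<bar>"
      by (intro mult_right_mono component_le_infnorm_cart) auto
    finally show "w $ j * u $ j \<le> infnorm w * \<bar>u $ j\<bar>" .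
  qed
  finally show ?thesis
    by (simp add: l1norm_def sum_distrib_left)
qed

section \<open>Compatibility on a cone\<close>

lemma compat_sq_nonneg:
  assumes "S \<noteq> {}" "L > 0"
  shows "0 \<le> compat_sq X L S"
  by (rule compat_sq_attained[OF assms, of X]) simp

text \<open>The sign of the part off \<open>S\<close> is flipped because \<open>compat_sq\<close> is built from a difference.\<close>
lemma compat_ratio_cone:
  fixes X :: "real ^ 'p ^ 'n"
  assumes "L > 0" and K: "compat_ratio X L S = ereal K"
    and cone: "l1norm (vrestrict (- S) u) \<le> L * l1norm (vrestrict S u)"
  shows "(l1norm (vrestrict S u))\<^sup>2 \<le> K * (nnorm (X *v u))\<^sup>2"
\<comment> \<open>For empty \<open>S\<close> the convention forces \<open>K = 0\<close>, and both
  sides vanish.\<close>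
proof (cases "S = {}")
  case True
  then show ?thesis
    using K by (simp add: compat_ratio_def vrestrict_empty l1norm_def zero_ereal_def)
next
  case False
  let ?a = "l1norm (vrestrict S u)"
  have pos: "compat_sq X L S > 0" and Keq: "K = real (card S) / compat_sq X L S"
    using K False compat_sq_nonneg[OF False \<open>L > 0\<close>, of X]
    by (auto simp: compat_ratio_def split: if_splits)
  have "compat_sq X L S * ?a\<^sup>2 \<le> real (card S) * (nnorm (X *v u))\<^sup>2"
  proof (cases "?a = 0")
    case True
    then show ?thesis by simp
  next
    case False
    then have a: "?a > 0"
      using l1norm_nonneg[of "vrestrict S u"] by simp
    \<comment> \<open>Dividing by \<open>?a\<close> gives the part on \<open>S\<close> norm one, and
      the cone condition then bounds the part off \<open>S\<close> by \<open>L\<close>.\<close>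
    define b where "b = (1 / ?a) *\<^sub>R (vrestrict S u - vrestrict (- S) u)"
    have bS: "vrestrict S b = (1 / ?a) *\<^sub>R vrestrict S u"
      and bSc: "vrestrict (- S) b = (- 1 / ?a) *\<^sub>R vrestrict (- S) u"
      by (simp_all add: b_def vrestrict_scaleR vrestrict_diff vrestrict_vrestrict vrestrict_empty)
    have "b \<in> compat_feasible L S"
      using a cone by (simp add: compat_feasible_def bS bSc l1norm_scaleR l1norm_uminus field_simps)
    moreover have "X *v vrestrict S b - X *v vrestrict (- S) b = (1 / ?a) *\<^sub>R (X *v u)"
    proof -
      have "vrestrict S b - vrestrict (- S) b = (1 / ?a) *\<^sub>R (vrestrict S u + vrestrict (- S) u)"
        by (simp add: bS bSc scaleR_add_right)
      then show ?thesis
        by (metis matrix_vector_mult_diff_distrib matrix_vector_mult_scaleR vrestrict_plus_compl)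
    qed
    ultimately have "compat_sq X L S \<le> real (card S) * ((1 / ?a)\<^sup>2 * (nnorm (X *v u))\<^sup>2)"
      using compat_sq_attained[OF \<open>S \<noteq> {}\<close> \<open>L > 0\<close>, of X] nnorm_scaleR_sq by metis
    then show ?thesis
      using a by (simp add: field_simps)
  qed
  then show ?thesis
    using pos by (simp add: Keq field_simps)
qed

text \<open>Arithmetic-geometric mean: \<open>a\<close> is at most the root of \<open>K * q\<close>.
  Comparing squares avoids the root, and the gap is the square of
  \<open>c\<^sup>2 * K - q\<close>.\<close>

lemma two_mult_le_of_square_le:
  fixes a c K q :: real
  assumes "a\<^sup>2 \<le> K * q" "0 \<le> K" "0 \<le> q"
  shows "2 * c * a \<le> c\<^sup>2 * K + q"
proof (rule power2_le_imp_le)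
  have "(2 * c * a)\<^sup>2 \<le> 4 * c\<^sup>2 * (K * q)"
    using mult_left_mono[OF assms(1), of "4 * c\<^sup>2"] by (simp add: power_mult_distrib)
  also have "\<dots> \<le> (c\<^sup>2 * K + q)\<^sup>2"
    using zero_le_power2[of "c\<^sup>2 * K - q"] by (simp add: power2_eq_square algebra_simps)
  finally show "(2 * c * a)\<^sup>2 \<le> (c\<^sup>2 * K + q)\<^sup>2" .
  show "0 \<le> c\<^sup>2 * K + q"
    using assms by simp
qed

section \<open>Optimality of the Lasso\<close>

text \<open>Optimality is tested along the segment from \<open>b\<close> to \<open>\<beta>\<close>, near \<open>b\<close>.\<close>
lemma lasso_two_point:
  fixes X :: "real ^ 'p ^ 'n"
  assumes lasso: "is_lasso X Y lam b" and "lam \<ge> 0"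
  shows "((Y - X *v b) \<bullet> (X *v (\<beta> - b))) / real CARD('n) \<le> lam * l1norm \<beta> - lam * l1norm b"
proof -
  let ?N = "real CARD('n)"
  define r d where "r = Y - X *v b" and "d = X *v (\<beta> - b)"
  \<comment> \<open>Moving from \<open>b\<close> a fraction \<open>t\<close> towards
    \<open>\<beta>\<close> raises the objective by at most
    \<open>t * (G + t * ((d \<bullet> d) / ?N))\<close>, so \<open>G\<close> is the first-order
    term.\<close>
  define G where "G = 2 * (lam * l1norm \<beta> - lam * l1norm b - (r \<bullet> d) / ?N)"
  have step: "0 \<le> G + t * ((d \<bullet> d) / ?N)" if t: "0 < t" "t \<le> 1" for t
  proof -
    define bt where "bt = b + t *\<^sub>R (\<beta> - b)"
    have "(nnorm (Y - X *v b))\<^sup>2 + 2 * lam * l1norm b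
        \<le> (nnorm (Y - X *v bt))\<^sup>2 + 2 * lam * l1norm bt"
      using lasso by (simp add: is_lasso_def is_arg_min_linorder)
    moreover have "Y - X *v bt = r - t *\<^sub>R d"
      unfolding bt_def r_def d_def
      by (simp add: matrix_vector_right_distrib matrix_vector_mult_scaleR)
    moreover have "(nnorm (r - t *\<^sub>R d))\<^sup>2
        = (nnorm r)\<^sup>2 - 2 * t * ((r \<bullet> d) / ?N) + t * t * ((d \<bullet> d) / ?N)"
      by (simp add: nnorm_sq inner_diff_left inner_diff_right inner_commute[of d r] field_simps)
    \<comment> \<open>Convexity of the penalty stands in for its derivative, which need not
      exist.\<close>
    moreover have "lam * l1norm bt \<le> lam * ((1 - t) * l1norm b + t * l1norm \<beta>)"
    proof (rule mult_left_mono[OF _ \<open>lam \<ge> 0\<close>])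
      have "bt = (1 - t) *\<^sub>R b + t *\<^sub>R \<beta>"
        by (simp add: bt_def algebra_simps)
      then show "l1norm bt \<le> (1 - t) * l1norm b + t * l1norm \<beta>"
        using l1norm_triangle[of "(1 - t) *\<^sub>R b" "t *\<^sub>R \<beta>"] t by (simp add: l1norm_scaleR)
    qed
    ultimately have "0 \<le> t * (G + t * ((d \<bullet> d) / ?N))"
      unfolding G_def r_def[symmetric] by (simp add: algebra_simps)
    then show ?thesis
      using t by (simp add: zero_le_mult_iff)
  qed
  \<comment> \<open>Letting \<open>t\<close> decrease to 0 removes the quadratic term.\<close>
  have "((\<lambda>t. G + t * ((d \<bullet> d) / ?N)) \<longlongrightarrow> G + 0 * ((d \<bullet> d) / ?N)) (at_right 0)"
    by (intro tendsto_intros)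
  moreover have "eventually (\<lambda>t. 0 \<le> G + t * ((d \<bullet> d) / ?N)) (at_right 0)"
    unfolding eventually_at_right_field using step by (intro exI[of _ 1]) auto
  ultimately have "0 \<le> G + 0 * ((d \<bullet> d) / ?N)"
    by (rule tendsto_lowerbound) simp
  then have "0 \<le> G"
    by simp
  then show ?thesis
    by (simp add: G_def r_def d_def)
qed

text \<open>With \<open>a\<close> and \<open>c\<close> the norms of
  \<open>\<beta>hat - \<beta>\<close> on and off \<open>S\<close>, the noise costs at most
  \<open>lam_eps * (a + c)\<close> and the penalty at most \<open>lam * (a - c)\<close>; the sum
  gives the two coefficients.\<close>

lemma lasso_basic_inequality:
  fixes X :: "real ^ 'p ^ 'n"
  assumes lasso: "is_lasso X Y lam \<beta>hat" and "lam \<ge> 0"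
    and noise: "lam_eps \<ge> infnorm ((Y - X *v \<beta>0) v* X) / real CARD('n)"
    and supp: "vrestrict (- S) \<beta> = 0"
  shows "((X *v (\<beta>hat - \<beta>)) \<bullet> (X *v (\<beta>hat - \<beta>0))) / real CARD('n)
    \<le> (lam + lam_eps) * l1norm (vrestrict S (\<beta>hat - \<beta>))
      - (lam - lam_eps) * l1norm (vrestrict (- S) (\<beta>hat - \<beta>))"
proof -
  let ?N = "real CARD('n)"
  define u \<epsilon> where "u = \<beta>hat - \<beta>" and "\<epsilon> = Y - X *v \<beta>0"
  define a c where "a = l1norm (vrestrict S u)" and "c = l1norm (vrestrict (- S) u)"
  have "Y - X *v \<beta>hat = \<epsilon> - X *v (\<beta>hat - \<beta>0)" and "X *v (\<beta> - \<beta>hat) = - (X *v u)"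
    by (simp_all add: \<epsilon>_def u_def matrix_vector_mult_diff_distrib)
  then have res: "(Y - X *v \<beta>hat) \<bullet> (X *v (\<beta> - \<beta>hat))
      = (X *v u) \<bullet> (X *v (\<beta>hat - \<beta>0)) - \<epsilon> \<bullet> (X *v u)"
    by (simp add: inner_diff_left inner_diff_right inner_commute)
  have "((X *v u) \<bullet> (X *v (\<beta>hat - \<beta>0))) / ?N
      \<le> (\<epsilon> \<bullet> (X *v u)) / ?N + lam * (l1norm \<beta> - l1norm \<beta>hat)"
    using lasso_two_point[OF lasso \<open>lam \<ge> 0\<close>, of \<beta>]
    unfolding res diff_divide_distrib right_diff_distrib by linarith
  moreover have "(\<epsilon> \<bullet> (X *v u)) / ?N \<le> lam_eps * (a + c)"
  proof -
    have "(\<epsilon> \<bullet> (X *v u)) / ?N \<le> infnorm (\<epsilon> v* X) * l1norm u / ?N"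
      using inner_le_infnorm_l1norm[of "\<epsilon> v* X" u]
      by (intro divide_right_mono) (simp_all add: dot_lmul_matrix)
    also have "\<dots> \<le> lam_eps * l1norm u"
      using mult_right_mono[OF noise l1norm_nonneg[of u]] by (simp add: \<epsilon>_def)
    finally show ?thesis
      by (simp add: a_def c_def l1norm_split[of u S])
  qed
  moreover have "lam * (l1norm \<beta> - l1norm \<beta>hat) \<le> lam * (a - c)"
  proof (rule mult_left_mono[OF _ \<open>lam \<ge> 0\<close>])
    \<comment> \<open>Since \<open>\<beta>\<close> vanishes off \<open>S\<close>, all of
      \<open>\<beta>hat\<close> there belongs to \<open>u\<close>, so \<open>c\<close> is counted in
      full with a minus sign.\<close>
    have "vrestrict (- S) \<beta>hat = vrestrict (- S) u"
      by (simp add: u_def vrestrict_diff supp)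
    moreover have "vrestrict S \<beta> = vrestrict S \<beta>hat + - vrestrict S u"
      by (simp add: u_def vrestrict_diff)
    then have "l1norm (vrestrict S \<beta>) \<le> l1norm (vrestrict S \<beta>hat) + a"
      using l1norm_triangle[of "vrestrict S \<beta>hat" "- vrestrict S u"]
      by (simp add: a_def l1norm_uminus)
    moreover have "l1norm (vrestrict (- S) \<beta>) = 0"
      by (simp add: supp l1norm_def)
    ultimately show "l1norm \<beta> - l1norm \<beta>hat \<le> a - c"
      using l1norm_split[of \<beta> S] l1norm_split[of \<beta>hat S] by (simp add: c_def)
  qed
  ultimately show ?thesis
    unfolding u_def[symmetric] a_def[symmetric] c_def[symmetric] by (simp add: algebra_simps)
qed

section \<open>Oracle inequality for a fixed comparison vector\<close>

lemma nnorm_sq_three_point: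
  "2 * (((x - y) \<bullet> (x - z)) / real CARD('n))
    = (nnorm (x - z))\<^sup>2 - (nnorm (y - z))\<^sup>2 + (nnorm (x - y :: real ^ 'n))\<^sup>2"
  by (simp add: nnorm_sq inner_diff_left inner_diff_right inner_commute field_simps)

text \<open>The approximation error keeps the factor one because the term
  \<open>(nnorm (X *v u))\<^sup>2\<close> produced by polarization pays exactly for the one spent in
  the arithmetic-geometric mean step.\<close>

lemma lasso_sharp_oracle:
  fixes X :: "real ^ 'p ^ 'n"
  assumes lasso: "is_lasso X Y lam \<beta>hat" and "lam \<ge> 0"
    and noise: "lam_eps \<ge> infnorm ((Y - X *v \<beta>0) v* X) / real CARD('n)"
    and \<delta>: "0 \<le> \<delta>" "\<delta> < 1" and "lam > lam_eps"
    and lam_star: "lam_star = lam + lam_eps + \<delta> * (lam - lam_eps)" "lam_star > 0"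
    and L: "L = lam_star / ((1 - \<delta>) * (lam - lam_eps))"
    and supp: "vrestrict (- S) \<beta> = 0"
    and K: "compat_ratio X L S = ereal K" "K \<ge> 0"
  shows "2 * \<delta> * (lam - lam_eps) * l1norm (\<beta>hat - \<beta>) + (nnorm (X *v (\<beta>hat - \<beta>0)))\<^sup>2
    \<le> (nnorm (X *v (\<beta> - \<beta>0)))\<^sup>2 + lam_star\<^sup>2 * K"
proof -
  define u where "u = \<beta>hat - \<beta>"
  define a c where "a = l1norm (vrestrict S u)" and "c = l1norm (vrestrict (- S) u)"
  define I where "I = ((X *v u) \<bullet> (X *v (\<beta>hat - \<beta>0))) / real CARD('n)"
  define D where "D = lam - lam_eps"
  have D: "D > 0"
    using \<open>lam > lam_eps\<close> by (simp add: D_def)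
  have u: "l1norm u = a + c"
    by (simp add: a_def c_def l1norm_split[of u S])
  have "2 * I = (nnorm (X *v (\<beta>hat - \<beta>0)))\<^sup>2 - (nnorm (X *v (\<beta> - \<beta>0)))\<^sup>2 + (nnorm (X *v u))\<^sup>2"
    unfolding I_def u_def matrix_vector_mult_diff_distrib by (rule nnorm_sq_three_point)
  moreover have "2 * (I + \<delta> * D * l1norm u) \<le> lam_star\<^sup>2 * K + (nnorm (X *v u))\<^sup>2"
  proof (cases "I + \<delta> * D * l1norm u \<le> 0")
    case True
    then have "2 * (I + \<delta> * D * l1norm u) \<le> 0"
      by (simp only: mult_le_0_iff) simp
    also have "0 \<le> lam_star\<^sup>2 * K + (nnorm (X *v u))\<^sup>2"
      using K(2) by simp
    finally show ?thesis .
  next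
    case False
    have "I \<le> (lam + lam_eps) * a - D * c"
      unfolding I_def a_def c_def u_def D_def
      by (rule lasso_basic_inequality[OF lasso \<open>lam \<ge> 0\<close> noise supp])
    \<comment> \<open>Adding \<open>\<delta> * D * (a + c)\<close> raises the coefficient of
      \<open>a\<close> to \<open>lam_star\<close> and lowers that of \<open>c\<close> to
      \<open>(1 - \<delta>) * D\<close>; their ratio is \<open>L\<close>.\<close>
    then have le: "I + \<delta> * D * l1norm u \<le> lam_star * a - (1 - \<delta>) * D * c"
      by (simp add: u lam_star D_def algebra_simps)
    with False have "(1 - \<delta>) * D * c \<le> lam_star * a"
      by linarith
    moreover have "(1 - \<delta>) * D > 0"
      using \<delta> D by simp
    ultimately have "c \<le> L * a" and "L > 0"
      using lam_star(2) by (simp_all add: L D_def[symmetric] field_simps)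
    then have "a\<^sup>2 \<le> K * (nnorm (X *v u))\<^sup>2"
      unfolding a_def c_def by (intro compat_ratio_cone[OF _ K(1)])
    then have amgm: "2 * lam_star * a \<le> lam_star\<^sup>2 * K + (nnorm (X *v u))\<^sup>2"
      by (rule two_mult_le_of_square_le) (use K in auto)
    have "0 \<le> (1 - \<delta>) * D * c"
      using \<delta> D l1norm_nonneg[of "vrestrict (- S) u"] by (simp add: c_def)
    with le have "I + \<delta> * D * l1norm u \<le> lam_star * a"
      by linarith
    from mult_left_mono[OF this, of 2] amgm show ?thesis
      by (simp only: mult.assoc) simp
  qed
  ultimately show ?thesis
    by (simp add: D_def u_def algebra_simps)
qed

section \<open>Passing from \<open>\<beta>star\<close> to \<open>\<beta>0\<close>\<close>

text \<open>All mass of \<open>\<beta>\<close> lies on \<open>S\<close>, so what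
  \<open>\<beta>0\<close> carries off \<open>S\<close> must be made up by the excess of
  \<open>\<beta>\<close> over \<open>\<beta>0\<close> on \<open>S\<close>.\<close>

lemma l1norm_off_active_set_le:
  assumes "l1norm \<beta>0 \<le> l1norm \<beta>" and supp: "vrestrict (- S) \<beta> = 0"
  shows "l1norm (vrestrict (- S) (\<beta> - \<beta>0)) \<le> l1norm (vrestrict S (\<beta> - \<beta>0))"
proof -
  have "l1norm (vrestrict (- S) (\<beta> - \<beta>0)) = l1norm (vrestrict (- S) \<beta>0)"
    by (simp add: vrestrict_diff supp l1norm_uminus)
  moreover have "l1norm \<beta> = l1norm (vrestrict S \<beta>)"
    using l1norm_split[of \<beta> S] by (simp add: supp l1norm_def)
  moreover have "l1norm (vrestrict S \<beta>)
      \<le> l1norm (vrestrict S \<beta>0) + l1norm (vrestrict S (\<beta> - \<beta>0))"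
    using l1norm_triangle[of "vrestrict S \<beta>0" "vrestrict S (\<beta> - \<beta>0)"]
    by (simp add: vrestrict_diff)
  ultimately show ?thesis
    using assms(1) l1norm_split[of \<beta>0 S] by linarith
qed

theorem corollary1p3p1:
  fixes X :: "real ^ 'p ^ 'n"
    and Y f0 \<epsilon> :: "real ^ 'n"
    and \<beta>0 \<beta>hat \<beta>star :: "real ^ 'p"
    and lam lam_eps lam_star \<delta> L :: real
    and Sstar :: "'p set"
  assumes rank_X: "rank X = CARD('n)"
    and beta0: "X *v \<beta>0 = f0"
    and eps: "\<epsilon> = Y - f0"
    and lam_pos: "lam > 0"
    and lasso: "is_lasso X Y lam \<beta>hat"
    and lam_eps: "lam_eps \<ge> infnorm (\<epsilon> v* X) / real CARD('n)"
    and delta: "0 \<le> \<delta>" "\<delta> < 1"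
    and lam_gt: "lam > lam_eps"
    and L: "L = (lam + lam_eps + \<delta> * (lam - lam_eps)) / ((1 - \<delta>) * (lam - lam_eps))"
    and lam_star: "lam_star = lam + lam_eps + \<delta> * (lam - lam_eps)"
    and beta_star: "is_arg_min
          (\<lambda>\<beta>. ereal ((nnorm (X *v (\<beta> - \<beta>0)))\<^sup>2)
                + ereal (lam_star\<^sup>2) * compat_ratio X L (active_set \<beta>))
          (\<lambda>\<beta>. l1norm \<beta> \<ge> l1norm \<beta>0) \<beta>star"
    and S_star: "Sstar = active_set \<beta>star"
  shows "ereal (2 * \<delta> * (lam - lam_eps) * l1norm (\<beta>hat - \<beta>0) + (nnorm (X *v (\<beta>hat - \<beta>0)))\<^sup>2)
    \<le> ereal ((lam + lam_eps + 3 * \<delta> * (lam - lam_eps)) / (lam + lam_eps + \<delta> * (lam - lam_eps))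
               * (nnorm (X *v (\<beta>star - \<beta>0)))\<^sup>2)
      + ereal ((lam + lam_eps + 3 * \<delta> * (lam - lam_eps)) * (lam + lam_eps + \<delta> * (lam - lam_eps)))
        * compat_ratio X L Sstar"
proof -
  define D M q where "D = lam - lam_eps" and "M = lam_star + 2 * \<delta> * D"
    and "q = (nnorm (X *v (\<beta>star - \<beta>0)))\<^sup>2"
  have "0 \<le> infnorm (\<epsilon> v* X) / real CARD('n)"
    by (simp add: infnorm_pos_le)
  with lam_eps have eps0: "0 \<le> lam_eps"
    by linarith
  have D: "D > 0"
    using lam_gt by (simp add: D_def)
  have star_pos: "lam_star > 0"
    unfolding lam_star D_def[symmetric] using lam_pos eps0 delta D
    by (intro add_pos_nonneg mult_nonneg_nonneg) auto
  \<comment> \<open>In \<open>M\<close>, the summand \<open>lam_star\<close> accounts for the oracle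
    inequality and \<open>2 * \<delta> * D\<close> for the distance from \<open>\<beta>star\<close>
    to \<open>\<beta>0\<close>.\<close>
  have M: "lam + lam_eps + 3 * \<delta> * (lam - lam_eps) = M"
    by (simp add: M_def lam_star D_def algebra_simps)
  have M_pos: "M > 0"
    unfolding M_def using star_pos delta D by (intro add_pos_nonneg) auto
  have L': "L = lam_star / ((1 - \<delta>) * D)"
    by (simp add: L lam_star D_def)
  have den: "(1 - \<delta>) * D > 0"
    using delta D by simp
  \<comment> \<open>The difference of the two sides is
    \<open>2 * lam_eps + 2 * \<delta> * D\<close>.\<close>
  have "(1 - \<delta>) * D \<le> lam_star"
    using delta D eps0 mult_nonneg_nonneg[of \<delta> D] by (simp add: lam_star D_def algebra_simps)
  then have L1: "L \<ge> 1"
    using den by (simp add: L')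
  have supp: "vrestrict (- Sstar) \<beta>star = 0"
    by (simp add: S_star vrestrict_compl_active_set)
  have l1: "l1norm \<beta>0 \<le> l1norm \<beta>star"
    using beta_star by (simp add: is_arg_min_def)
  show ?thesis
  proof (cases "compat_ratio X L Sstar = \<infinity>")
    \<comment> \<open>The coefficient of the infinite ratio is positive, so the right-hand side is
      infinite.\<close>
    case True
    then show ?thesis
      using star_pos M_pos by (simp add: M lam_star[symmetric])
  next
    case False
    then obtain K where K: "compat_ratio X L Sstar = ereal K" "K \<ge> 0"
      using compat_sq_nonneg[of Sstar L X] L1
      by (auto simp: compat_ratio_def zero_ereal_def split: if_splits)
    let ?a = "l1norm (vrestrict Sstar (\<beta>star - \<beta>0))"
    have off: "l1norm (vrestrict (- Sstar) (\<beta>star - \<beta>0)) \<le> ?a"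
      by (rule l1norm_off_active_set_le[OF l1 supp])
    also have "\<dots> \<le> L * ?a"
      using mult_right_mono[OF L1 l1norm_nonneg[of "vrestrict Sstar (\<beta>star - \<beta>0)"]] by simp
    finally have "?a\<^sup>2 \<le> K * q"
      unfolding q_def using L1 by (intro compat_ratio_cone[OF _ K(1)]) auto
    \<comment> \<open>Weighting by \<open>lam_star\<close> makes this bound, once divided by
      \<open>lam_star\<close>, a multiple of the oracle bound, so the two merge at the end.\<close>
    then have "2 * lam_star * ?a \<le> lam_star\<^sup>2 * K + q"
      by (rule two_mult_le_of_square_le) (use K in \<open>auto simp: q_def\<close>)
    then have "2 * ?a \<le> lam_star * K + q / lam_star"
      using star_pos by (simp add: field_simps power2_eq_square)
    \<comment> \<open>The parts on and off \<open>Sstar\<close> are each at most \<open>?a\<close>,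
      which uses up the factor 2.\<close>
    then have dist: "l1norm (\<beta>star - \<beta>0) \<le> lam_star * K + q / lam_star"
      using off l1norm_split[of "\<beta>star - \<beta>0" Sstar] by linarith
    have "l1norm (\<beta>hat - \<beta>0) \<le> l1norm (\<beta>hat - \<beta>star) + l1norm (\<beta>star - \<beta>0)"
      using l1norm_triangle[of "\<beta>hat - \<beta>star" "\<beta>star - \<beta>0"] by simp
    with dist have "l1norm (\<beta>hat - \<beta>0)
        \<le> l1norm (\<beta>hat - \<beta>star) + (lam_star * K + q / lam_star)"
      by linarith
    from mult_left_mono[OF this, of "2 * \<delta> * D"]
    have "2 * \<delta> * D * l1norm (\<beta>hat - \<beta>0)
        \<le> 2 * \<delta> * D * l1norm (\<beta>hat - \<beta>star) + 2 * \<delta> * D * (lam_star * K + q / lam_star)"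
      using delta D by (simp add: algebra_simps)
    moreover have "2 * \<delta> * D * l1norm (\<beta>hat - \<beta>star) + (nnorm (X *v (\<beta>hat - \<beta>0)))\<^sup>2
        \<le> q + lam_star\<^sup>2 * K"
      unfolding q_def D_def
      using lasso_sharp_oracle[OF lasso _ _ delta lam_gt lam_star star_pos _ supp K]
        lam_eps lam_pos L' by (simp add: eps beta0 D_def)
    moreover have "q + lam_star\<^sup>2 * K + 2 * \<delta> * D * (lam_star * K + q / lam_star)
        = M / lam_star * q + M * lam_star * K"
      using star_pos by (simp add: M_def field_simps power2_eq_square)
    ultimately have "2 * \<delta> * D * l1norm (\<beta>hat - \<beta>0) + (nnorm (X *v (\<beta>hat - \<beta>0)))\<^sup>2
        \<le> M / lam_star * q + M * lam_star * K"
      by linarith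
    then show ?thesis
      by (simp add: M lam_star[symmetric] K D_def q_def)
  qed
qed

end
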